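(* Let $\mathcal{H}\subset\mathbb{R}^n$ be compact with convex hull $\mathcal{S}$, and assume that $\partial\mathcal{S}=\{h\in\mathbb{R}^n : \|h\|_2^2=r^2\}$ for some $r\ge0$. Let $\Sigma=\operatorname{diag}(\sigma_1,\dots,\sigma_n)$ with real $\sigma_i$, $|\sigma_1|\ge\cdots\ge|\sigma_n|$, and let $V\in\mathbb{R}^{n\times n}$ be orthogonal. For an orthogonal matrix $U\in\mathbb{R}^{n\times n}$ let $E=U\Sigma V^\top$ and $$\Delta_1g_e=\max_{v,v'\in E(\mathcal{H})}\|v-v'\|_1 .$$ Then, for the given $\Sigma$, $U=I$ minimizes $\Delta_1g_e$ over all orthogonal $U\in\mathbb{R}^{n\times n}$, and the corresponding minimum value is $$\Delta_1g_e=2r\sqrt{\sum_{i=1}^n\sigma_i^2}.$$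
   Context: $E(\mathcal{H})=\{Eh : h\in\mathcal{H}\}$. The quantity $\Delta_1g_e$ is the $\ell_1$-sensitivity of the linear encoder $h\mapsto Eh$ on the data domain $\mathcal{H}$. The latent dimension is taken to be $n$, so all matrices are $n\times n$. *)

theory Defs
  imports "HOL-Analysis.Analysis"
begin

definition l1_norm :: "real ^ 'n \<Rightarrow> real" where
  "l1_norm x = (\<Sum>i\<in>UNIV. \<bar>x $ i\<bar>)"

definition diag :: "real ^ 'n \<Rightarrow> real ^ 'n ^ 'n" where
  "diag s = (\<chi> i j. if i = j then s $ i else 0)"

definition encoder :: "real ^ 'n ^ 'n \<Rightarrow> real ^ 'n \<Rightarrow> real ^ 'n ^ 'n \<Rightarrow> real ^ 'n ^ 'n" where
  "encoder U s V = U ** diag s ** transpose V"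

(* The maximum is rendered by Greatest, which is only meaningful when a maximum exists;
   l1_sensitivity_attained and l1_sensitivity_upper below show that this is the case for
   every nonempty compact data domain. *)
definition l1_sensitivity :: "real ^ 'n ^ 'n \<Rightarrow> (real ^ 'n) set \<Rightarrow> real" where
  "l1_sensitivity E D =
     (GREATEST d. \<exists>v \<in> (*v) E ` D. \<exists>v' \<in> (*v) E ` D. d = l1_norm (v - v'))"

lemma l1_sensitivity_max:
  fixes E :: "real ^ 'n ^ 'n"
  assumes "compact D" "D \<noteq> {}"
  shows "\<exists>v \<in> (*v) E ` D. \<exists>v' \<in> (*v) E ` D. l1_sensitivity E D = l1_norm (v - v') \<and>
           (\<forall>w \<in> (*v) E ` D. \<forall>w' \<in> (*v) E ` D. l1_norm (w - w') \<le> l1_norm (v - v'))"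
proof -
  let ?A = "(*v) E ` D"
  let ?f = "\<lambda>p :: (real ^ 'n) \<times> (real ^ 'n). l1_norm (fst p - snd p)"
  have "continuous_on D ((*v) E)"
    by (simp add: linear_continuous_on linear_linear)
  then have "compact ?A"
    using assms(1) by (rule compact_continuous_image)
  then have "compact (?A \<times> ?A)"
    by (rule compact_Times) fact
  moreover have "?A \<times> ?A \<noteq> {}"
    using assms(2) by simp
  moreover have "continuous_on (?A \<times> ?A) ?f"
    unfolding l1_norm_def by (intro continuous_intros)
  ultimately obtain p where p: "p \<in> ?A \<times> ?A" "\<forall>q \<in> ?A \<times> ?A. ?f q \<le> ?f p"
    using continuous_attains_sup[of "?A \<times> ?A" ?f] by blast
  obtain v v' where vv: "p = (v, v')" "v \<in> ?A" "v' \<in> ?A"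
    using p(1) by (rule SigmaE)
  have max: "\<forall>w \<in> ?A. \<forall>w' \<in> ?A. l1_norm (w - w') \<le> l1_norm (v - v')"
  proof (intro ballI)
    fix w w' assume "w \<in> ?A" "w' \<in> ?A"
    then have "(w, w') \<in> ?A \<times> ?A"
      by (rule SigmaI)
    then have "?f (w, w') \<le> ?f p"
      using p(2) by (rule bspec[rotated])
    then show "l1_norm (w - w') \<le> l1_norm (v - v')"
      by (simp only: vv(1) fst_conv snd_conv)
  qed
  have "l1_sensitivity E D = l1_norm (v - v')"
    unfolding l1_sensitivity_def
  proof (rule Greatest_equality)
    show "\<exists>w \<in> ?A. \<exists>w' \<in> ?A. l1_norm (v - v') = l1_norm (w - w')"
      using vv(2,3) by blast
  next
    fix d assume "\<exists>w \<in> ?A. \<exists>w' \<in> ?A. d = l1_norm (w - w')"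
    then show "d \<le> l1_norm (v - v')"
      using max by blast
  qed
  then show ?thesis
    using vv(2,3) max by blast
qed

lemma l1_sensitivity_attained:
  assumes "compact D" "D \<noteq> {}"
  shows "\<exists>v \<in> (*v) E ` D. \<exists>v' \<in> (*v) E ` D. l1_sensitivity E D = l1_norm (v - v')"
  using l1_sensitivity_max[OF assms] by blast

lemma l1_sensitivity_upper:
  assumes "compact D" "v \<in> (*v) E ` D" "v' \<in> (*v) E ` D"
  shows "l1_norm (v - v') \<le> l1_sensitivity E D"
proof -
  have "D \<noteq> {}"
    using assms(2) by blast
  then show ?thesis
    using l1_sensitivity_max[OF assms(1), of E] assms(2,3) by force
qed

end

(* The hypothesis on the frontier forces sphere 0 r \<subseteq> H \<subseteq> cball 0 r, because the
   extreme points of a convex hull lie in the generating set. Antipodal points of the sphere give a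
   sensitivity of at least 2 * r * max {l1_norm (E *v w) | norm w = 1}. Choosing signs s
   greedily such that the signed sum x of the rows of E satisfies
   norm x ^ 2 \<ge> sum of the squared row norms, and testing with w = x / norm x, bounds this
   maximum from below by the Frobenius norm of E, which is the Euclidean norm of \<sigma> whatever U
   and V are. For U = I, the Cauchy-Schwarz inequality gives the matching upper bound. *)

theory Submission
  imports Defs
begin

text \<open>By Krein-Milman a compact convex set is the convex hull of its frontier, so two such
  sets with the same frontier coincide.\<close>

lemma cball_if_frontier_eq_sphere:
  fixes S :: "'a::euclidean_space set"
  assumes "compact S" "convex S" "frontier S = sphere a r"
  shows "S = cball a r"
proof -
  have "S = convex hull (frontier S)"
    using Krein_Milman_frontier assms(1,2) by blast
  also have "\<dots> = cball a r"
    using Krein_Milman_frontier[of "cball a r"] assms(3) by simp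
  finally show ?thesis .
qed

text \<open>Strict convexity of the ball: a point of an open segment is strictly closer to
  \<open>a\<close> than one of the endpoints, so a point at distance \<open>r\<close> lies inside no
  segment of the ball.\<close>

lemma sphere_subset_if_convex_hull_eq_cball:
  fixes H :: "'a::euclidean_space set"
  assumes "convex hull H = cball a r"
  shows "sphere a r \<subseteq> H"
proof
  fix x assume "x \<in> sphere a r"
  then have "x extreme_point_of (convex hull H)"
    unfolding assms extreme_point_of_def
    by (auto dest: dist_decreases_open_segment[where c = a])
  then show "x \<in> H"
    by (rule extreme_point_of_convex_hull)
qed

text \<open>For a matrix, seen as the vector of its rows, \<open>norm\<close> is therefore the
  Frobenius norm.\<close>

lemma power2_norm_vec:
  fixes x :: "'a::real_normed_vector ^ 'n::finite"
  shows "(norm x)\<^sup>2 = (\<Sum>i\<in>UNIV. (norm (x $ i))\<^sup>2)"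
  unfolding norm_vec_def L2_set_def by (simp add: sum_nonneg)

lemma norm_transpose:
  fixes A :: "real ^ 'n::finite ^ 'm::finite"
  shows "norm (transpose A) = norm A"
proof -
  have "(norm (transpose A))\<^sup>2 = (norm A)\<^sup>2"
    unfolding power2_norm_vec transpose_def by (simp, rule sum.swap)
  then show ?thesis by simp
qed

lemma norm_orthogonal_matrix_vector_mult:
  fixes Q :: "real ^ 'n::finite ^ 'n"
  assumes "orthogonal_matrix Q"
  shows "norm (Q *v x) = norm x"
  using assms by (simp add: orthogonal_transformation_matrix orthogonal_transformation_norm)

lemma norm_orthogonal_vector_matrix_mult:
  fixes Q :: "real ^ 'n::finite ^ 'n"
  assumes "orthogonal_matrix Q"
  shows "norm (x v* Q) = norm x"
  using norm_orthogonal_matrix_vector_mult[of "transpose Q" x] assms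
  by (simp add: orthogonal_matrix_transpose)

text \<open>\<open>Q\<close> acts as an isometry on each row, and the squared row norms add up to
  the squared Frobenius norm.\<close>

lemma norm_matrix_mult_orthogonal_right:
  fixes A :: "real ^ 'n::finite ^ 'm::finite" and Q :: "real ^ 'n ^ 'n"
  assumes "orthogonal_matrix Q"
  shows "norm (A ** Q) = norm A"
proof -
  have row: "(A ** Q) $ i = A $ i v* Q" for i
    by (simp add: vec_eq_iff matrix_matrix_mult_def vector_matrix_mult_def mult.commute)
  have "(norm (A ** Q))\<^sup>2 = (norm A)\<^sup>2"
    unfolding power2_norm_vec[of "A ** Q"] power2_norm_vec[of A] row
    using assms by (simp add: norm_orthogonal_vector_matrix_mult)
  then show ?thesis by simp
qed

lemma norm_matrix_mult_orthogonal_left: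
  fixes A :: "real ^ 'n::finite ^ 'm::finite" and Q :: "real ^ 'm ^ 'm"
  assumes "orthogonal_matrix Q"
  shows "norm (Q ** A) = norm A"
proof -
  have "norm (Q ** A) = norm (transpose A ** transpose Q)"
    by (metis matrix_transpose_mul norm_transpose)
  also have "\<dots> = norm A"
    using assms
    by (simp add: norm_matrix_mult_orthogonal_right orthogonal_matrix_transpose norm_transpose)
  finally show ?thesis .
qed

lemma norm_diag: "norm (diag s) = norm s"
proof -
  have "(\<Sum>j\<in>UNIV. \<bar>if i = j then s $ i else 0\<bar>\<^sup>2) = (s $ i)\<^sup>2" for i
  proof -
    have "(\<Sum>j\<in>UNIV. \<bar>if i = j then s $ i else 0\<bar>\<^sup>2) =
        (\<Sum>j\<in>UNIV. if i = j then (s $ i)\<^sup>2 else 0)"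
      by (intro sum.cong) auto
    then show ?thesis by simp
  qed
  then have "(norm (diag s))\<^sup>2 = (norm s)\<^sup>2"
    by (simp add: power2_norm_vec diag_def)
  then show ?thesis by simp
qed

text \<open>This makes the lower bound on the sensitivity the same for all orthogonal
  \<open>U\<close>.\<close>

lemma norm_encoder:
  assumes "orthogonal_matrix U" "orthogonal_matrix V"
  shows "norm (encoder U s V) = norm s"
  using assms
  by (simp add: encoder_def norm_matrix_mult_orthogonal_left norm_matrix_mult_orthogonal_right
      orthogonal_matrix_transpose norm_diag)

lemma norm_add_or_diff_ge:
  fixes x a :: "'a::real_inner"
  obtains t :: real where "\<bar>t\<bar> = 1" "(norm (x + t *\<^sub>R a))\<^sup>2 \<ge> (norm x)\<^sup>2 + (norm a)\<^sup>2"
proof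
  \<comment> \<open>This sign makes the cross term of the expanded square nonnegative.\<close>
  define t :: real where "t = (if x \<bullet> a \<ge> 0 then 1 else - 1)"
  show "\<bar>t\<bar> = 1" by (simp add: t_def)
  have "t * (x \<bullet> a) \<ge> 0" "t * t = 1" by (auto simp: t_def)
  moreover have "(norm (x + t *\<^sub>R a))\<^sup>2 = (norm x)\<^sup>2 + 2 * (t * (x \<bullet> a)) + (t * t) * (norm a)\<^sup>2"
    unfolding power2_norm_eq_inner by (simp add: inner_simps inner_commute algebra_simps)
  ultimately show "(norm (x + t *\<^sub>R a))\<^sup>2 \<ge> (norm x)\<^sup>2 + (norm a)\<^sup>2" by simp
qed

text \<open>For independent uniform signs the expected squared norm equals the left-hand sum. The
  induction derandomises this, fixing one sign at a time.\<close>

lemma exists_signed_sum_norm_ge: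
  fixes a :: "'i \<Rightarrow> 'a::real_inner"
  assumes "finite I"
  shows "\<exists>s :: 'i \<Rightarrow> real. (\<forall>i. \<bar>s i\<bar> = 1) \<and>
    (\<Sum>i\<in>I. (norm (a i))\<^sup>2) \<le> (norm (\<Sum>i\<in>I. s i *\<^sub>R a i))\<^sup>2"
  using assms
proof (induction I rule: finite_induct)
  case empty
  show ?case by (intro exI[of _ "\<lambda>_. 1"]) simp
next
  case (insert j I)
  then obtain s :: "'i \<Rightarrow> real" where s: "\<And>i. \<bar>s i\<bar> = 1"
    "(\<Sum>i\<in>I. (norm (a i))\<^sup>2) \<le> (norm (\<Sum>i\<in>I. s i *\<^sub>R a i))\<^sup>2"
    by blast
  obtain t :: real where t: "\<bar>t\<bar> = 1"
    "(norm ((\<Sum>i\<in>I. s i *\<^sub>R a i) + t *\<^sub>R a j))\<^sup>2 \<ge>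
      (norm (\<Sum>i\<in>I. s i *\<^sub>R a i))\<^sup>2 + (norm (a j))\<^sup>2"
    using norm_add_or_diff_ge .
  have "(\<Sum>i\<in>I. (s(j := t)) i *\<^sub>R a i) = (\<Sum>i\<in>I. s i *\<^sub>R a i)"
    using insert.hyps by (intro sum.cong) auto
  then show ?case
    using insert.hyps s t by (intro exI[of _ "s(j := t)"]) (auto simp: add.commute)
qed

lemma l1_norm_scaleR: "l1_norm (c *\<^sub>R x) = \<bar>c\<bar> * l1_norm x"
  by (simp add: l1_norm_def abs_mult sum_distrib_left)

text \<open>Pairing a vector with signs \<open>s\<close> bounds its l1 norm from below. For
  \<open>E *v x\<close>, where \<open>x\<close> is the signed sum of the rows of \<open>E\<close>,
  the pairing equals the inner product of \<open>x\<close> with itself; dividing by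
  \<open>norm x\<close> leaves \<open>norm x\<close>, which is at least
  \<open>norm E\<close>.\<close>

lemma exists_unit_vector_l1_norm_ge:
  fixes E :: "real ^ 'n::finite ^ 'n"
  shows "\<exists>w. norm w = 1 \<and> norm E \<le> l1_norm (E *v w)"
proof -
  obtain s :: "'n \<Rightarrow> real" where s: "\<And>i. \<bar>s i\<bar> = 1"
    "(\<Sum>i\<in>UNIV. (norm (E $ i))\<^sup>2) \<le> (norm (\<Sum>i\<in>UNIV. s i *\<^sub>R E $ i))\<^sup>2"
    using exists_signed_sum_norm_ge[of "UNIV :: 'n set" "\<lambda>i. E $ i"] by auto
  define x where "x = (\<Sum>i\<in>UNIV. s i *\<^sub>R E $ i)"
  have "(norm E)\<^sup>2 \<le> (norm x)\<^sup>2"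
    using s(2) by (simp add: x_def power2_norm_vec[of E])
  then have Ex: "norm E \<le> norm x"
    by (rule power2_le_imp_le) simp
  show ?thesis
  proof (cases "x = 0")
    \<comment> \<open>\<open>x\<close> cannot be normalised, but \<open>E\<close> has norm 0, so any
      unit vector serves.\<close>
    case True
    then have "norm E = 0" using Ex by simp
    moreover obtain w :: "real ^ 'n" where "norm w = 1"
      using vector_choose_size[of 1] by auto
    ultimately show ?thesis
      by (intro exI[of _ w]) (simp add: l1_norm_def sum_nonneg)
  next
    case False
    have "norm x * norm x = x \<bullet> x"
      by (simp add: power2_norm_eq_inner flip: power2_eq_square)
    also have "\<dots> = (\<Sum>i\<in>UNIV. s i * (E *v x) $ i)"
      \<comment> \<open>Only the left factor is expanded; the inner product of row
        \<open>E $ i\<close> with the right factor is an entry of \<open>E *v x\<close>.\<close>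
      by (subst (1) x_def) (simp add: inner_sum_left matrix_vector_mul_component)
    also have "\<dots> \<le> l1_norm (E *v x)"
      unfolding l1_norm_def
    proof (rule sum_mono)
      fix i
      have "s i * (E *v x) $ i \<le> \<bar>s i\<bar> * \<bar>(E *v x) $ i\<bar>"
        by (metis abs_ge_self abs_mult)
      then show "s i * (E *v x) $ i \<le> \<bar>(E *v x) $ i\<bar>"
        by (simp add: s(1))
    qed
    finally have "norm x \<le> l1_norm (E *v x) / norm x"
      using False by (simp add: field_simps)
    also have "\<dots> = l1_norm (E *v (inverse (norm x) *\<^sub>R x))"
      by (simp add: matrix_vector_mult_scaleR l1_norm_scaleR divide_inverse mult.commute)
    finally show ?thesis
      using False Ex by (intro exI[of _ "inverse (norm x) *\<^sub>R x"]) simp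
  qed
qed

lemma l1_sensitivity_ge_norm:
  fixes E :: "real ^ 'n::finite ^ 'n"
  assumes "compact D" "sphere 0 r \<subseteq> D" "r \<ge> 0"
  shows "2 * r * norm E \<le> l1_sensitivity E D"
proof -
  obtain w where w: "norm w = 1" "norm E \<le> l1_norm (E *v w)"
    using exists_unit_vector_l1_norm_ge by blast
  \<comment> \<open>These antipodal points differ by \<open>2 * r\<close> times \<open>w\<close>,
    the source of the factor \<open>2 * r\<close>.\<close>
  have "r *\<^sub>R w \<in> D" "- (r *\<^sub>R w) \<in> D"
    using assms(2,3) w(1) by (auto simp: subset_iff)
  then have "l1_norm (E *v (r *\<^sub>R w) - E *v (- (r *\<^sub>R w))) \<le> l1_sensitivity E D"
    using assms(1) by (intro l1_sensitivity_upper imageI)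
  also have "E *v (r *\<^sub>R w) - E *v (- (r *\<^sub>R w)) = E *v ((2 * r) *\<^sub>R w)"
    unfolding matrix_vector_mult_diff_distrib[symmetric]
    by (simp flip: scaleR_left_distrib)
  also have "\<dots> = (2 * r) *\<^sub>R (E *v w)"
    by (rule matrix_vector_mult_scaleR)
  finally have "2 * r * l1_norm (E *v w) \<le> l1_sensitivity E D"
    using assms(3) by (simp add: l1_norm_scaleR)
  moreover have "2 * r * norm E \<le> 2 * r * l1_norm (E *v w)"
    using w(2) assms(3) by (intro mult_left_mono) auto
  ultimately show ?thesis by simp
qed

text \<open>A diagonal matrix rescales entrywise, so the left side is the inner product of the
  vectors of absolute values, and Cauchy-Schwarz applies.\<close>

lemma l1_norm_diag_mult_le: "l1_norm (diag s *v y) \<le> norm s * norm y"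
proof -
  have "(diag s *v y) $ i = s $ i * y $ i" for i
  proof -
    have "(diag s *v y) $ i = (\<Sum>j\<in>UNIV. if i = j then s $ i * y $ j else 0)"
      unfolding matrix_vector_mult_def diag_def vec_lambda_beta by (intro sum.cong) auto
    then show ?thesis by simp
  qed
  then have "l1_norm (diag s *v y) = (\<Sum>i\<in>UNIV. \<bar>s $ i\<bar> * \<bar>y $ i\<bar>)"
    by (simp add: l1_norm_def abs_mult)
  also have "\<dots> \<le> norm s * norm y"
    using L2_set_mult_ineq[of "\<lambda>i. s $ i" "\<lambda>i. y $ i" UNIV] by (simp add: norm_vec_def L2_set_def)
  finally show ?thesis .
qed

text \<open>With \<open>U = I\<close> only the isometry \<open>transpose V\<close> precedes the
  diagonal matrix, and points of the ball are at most \<open>2 * r\<close> apart.\<close>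

lemma l1_sensitivity_encoder_mat_1_le:
  assumes "compact D" "D \<noteq> {}" "D \<subseteq> cball 0 r" "orthogonal_matrix V"
  shows "l1_sensitivity (encoder (mat 1) s V) D \<le> 2 * r * norm s"
proof -
  let ?E = "encoder (mat 1) s V"
  obtain h h' where h: "h \<in> D" "h' \<in> D" "l1_sensitivity ?E D = l1_norm (?E *v h - ?E *v h')"
    using l1_sensitivity_attained[OF assms(1,2), of ?E] by auto
  have "l1_sensitivity ?E D = l1_norm (diag s *v (transpose V *v (h - h')))"
    unfolding h(3) matrix_vector_mult_diff_distrib[symmetric]
    by (simp add: encoder_def matrix_vector_mul_assoc del: transpose_matrix_vector)
  also have "\<dots> \<le> norm s * norm (h - h')"
    using l1_norm_diag_mult_le[of s "transpose V *v (h - h')"] assms(4)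
    by (simp add: norm_orthogonal_vector_matrix_mult)
  also have "\<dots> \<le> norm s * (2 * r)"
  proof (rule mult_left_mono)
    have "norm h \<le> r" "norm h' \<le> r"
      using h(1,2) assms(3) by auto
    then show "norm (h - h') \<le> 2 * r"
      using norm_triangle_ineq4[of h h'] by linarith
  qed simp
  finally show ?thesis by (simp add: mult.commute)
qed

theorem proposition4p5:
  fixes H :: "(real ^ ('n::{finite,linorder})) set"
    and \<sigma> :: "real ^ ('n::{finite,linorder})"
    and V :: "real ^ ('n::{finite,linorder}) ^ ('n::{finite,linorder})"
    and r :: real
  assumes "compact H"
    and "r \<ge> 0"
    and "frontier (convex hull H) = {h. (norm h)\<^sup>2 = r\<^sup>2}"
    and "\<And>i j. i \<le> j \<Longrightarrow> \<bar>\<sigma> $ j\<bar> \<le> \<bar>\<sigma> $ i\<bar>"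
    and "orthogonal_matrix V"
  shows "is_arg_min (\<lambda>U. l1_sensitivity (encoder U \<sigma> V) H) orthogonal_matrix (mat 1) \<and>
         l1_sensitivity (encoder (mat 1) \<sigma> V) H = 2 * r * sqrt (\<Sum>i\<in>UNIV. (\<sigma> $ i)\<^sup>2)"
proof -
  have "{h. (norm h)\<^sup>2 = r\<^sup>2} = sphere 0 r"
    using assms(2) by (auto simp: power2_eq_iff_nonneg)
  then have hull: "convex hull H = cball 0 r"
    using assms(1,3)
    by (intro cball_if_frontier_eq_sphere) (auto simp: compact_convex_hull)
  have sphere: "sphere 0 r \<subseteq> H"
    using hull by (rule sphere_subset_if_convex_hull_eq_cball)
  have "H \<subseteq> cball 0 r"
    using hull hull_subset[of H convex] by simp
  \<comment> \<open>Nonemptiness ensures that the maximum defining the sensitivity is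
    attained.\<close>
  moreover have "H \<noteq> {}"
  proof
    assume "H = {}"
    moreover have "0 \<in> convex hull H"
      using assms(2) by (simp add: hull)
    ultimately show False by simp
  qed
  ultimately have upper: "l1_sensitivity (encoder (mat 1) \<sigma> V) H \<le> 2 * r * norm \<sigma>"
    using assms(1,5) by (intro l1_sensitivity_encoder_mat_1_le)
  have lower: "2 * r * norm \<sigma> \<le> l1_sensitivity (encoder U \<sigma> V) H" if "orthogonal_matrix U" for U
    using l1_sensitivity_ge_norm[OF assms(1) sphere assms(2), of "encoder U \<sigma> V"]
      norm_encoder[OF that assms(5), of \<sigma>] by simp
  \<comment> \<open>At \<open>U = I\<close> both bounds meet, so the value there is the lower bound
    shared by all orthogonal \<open>U\<close>; minimality follows.\<close>
  have eq: "l1_sensitivity (encoder (mat 1) \<sigma> V) H = 2 * r * norm \<sigma>"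
    using upper lower[OF orthogonal_matrix_id] by simp
  have "is_arg_min (\<lambda>U. l1_sensitivity (encoder U \<sigma> V) H) orthogonal_matrix (mat 1)"
    unfolding is_arg_min_def eq using lower orthogonal_matrix_id by (auto simp: not_less)
  then show ?thesis
    using eq by (simp add: norm_vec_def L2_set_def)
qed

end
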